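(* For every $\tau\in\mathbb{R}_{\ge0}^{|E|T}$ and $B\in\mathbb{R}_{\ge0}^{|G^E|}$, the set of $(\tau,B)$-CBCP equilibrium flows is non-empty.
   Context: Network. $(I,E)$ is a finite acyclic directed graph; $E_i^{\mathrm{in}},E_i^{\mathrm{out}}$ are the edges entering/leaving node $i$. Each edge has two lanes $k\in[2]=\{1,2\}$: an express lane ($k=1$, may be tolled) and a toll-free general-purpose lane ($k=2$). Both lanes of $e$ have the same latency function $\ell_e:\mathbb{R}\to\mathbb{R}$, strictly increasing, convex, nonnegative on $\mathbb{R}_{\ge0}$. Periods are $t\in[T]=\{1,\dots,T\}$. Users. $G=G^E\sqcup G^I$ is a finite set of groups, eligible ($G^E$) or ineligible ($G^I$). Group $g$ has an origin $p_o^g$ and destination $p_d^g$ joined by at least one directed route, a demand $d^g\ge0$, and values of time $v_t^g>0$, $t\in[T]$. $G_e$ is the set of groups having a route from $p_o^g$ to $p_d^g$ containing $e$; $n=\sum_{e}|G_e|$. Flows. A flow is $y=(y_{e,k,t}^g: e\in E,k\in[2],t\in[T],g\in G_e)\in\mathbb{R}_{\ge0}^{2nT}$; $\mathcal{Y}_{\mathrm{adm}}$ is the set of flows such that for all $i\in I,g\in G,t\in[T]$: $d^g\mathbf 1\{i=p_o^g\}+\sum_{e\in E_i^{\mathrm{in}}}\sum_{k}y_{e,k,t}^g=d^g\mathbf 1\{i=p_d^g\}+\sum_{e\in E_i^{\mathrm{out}}}\sum_{k}y_{e,k,t}^g$ (sums over edges with $g\in G_e$). Lane flows: $x_{e,k,t}=\sum_{g\in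 G_e}y_{e,k,t}^g$. CBCP (credit-based congestion pricing). A policy is $(\tau,B)$ with tolls $\tau\in\mathbb{R}_{\ge0}^{|E|T}$ and budgets $B\in\mathbb{R}_{\ge0}^{|G^E|}$. The feasible set is $\mathcal{Y}^C(\tau,B)=\{y\in\mathcal{Y}_{\mathrm{adm}}:\sum_{t}\sum_{e}y_{e,1,t}^g\tau_{e,t}\le B^g\ \forall g\in G^E\}$. The cost $c_{e,k,t}^g(y)$ is $v_t^g\ell_e(x_{e,1,t})+\tau_{e,t}$ if $k=1,g\in G^I$, and $v_t^g\ell_e(x_{e,k,t})$ otherwise. A flow $y^\star\in\mathcal{Y}^C(\tau,B)$ is a $(\tau,B)$-CBCP equilibrium if for each $g\in G$ and every $y\in\mathcal{Y}^C(\tau,B)$: $\sum_{e,k,t}(y_{e,k,t}^g-y_{e,k,t}^{g\star})c_{e,k,t}^g(y^\star)\ge0$. *)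

theory Defs
  imports "HOL-Analysis.Analysis" "Graph_Theory.Graph_Theory"
begin

text \<open>
  The network is a finite multi-digraph (parallel edges are allowed, not required).
  Lanes are \<open>k \<in> {1, 2}\<close>, lane 1 being the express lane; periods are \<open>t \<in> {1..T}\<close>.
  \<open>GE\<close> and \<open>GI\<close> are the eligible and the ineligible groups.  The latency functions are
  only constrained on the nonnegative half-line, the only place where they are evaluated.
\<close>

locale cbcp_network = fin_digraph N
  for N :: "('i, 'e) pre_digraph" (structure) +
  fixes T :: nat
    and GE GI :: "'g set"
    and orig dest :: "'g \<Rightarrow> 'i"
    and d :: "'g \<Rightarrow> real"
    and v :: "'g \<Rightarrow> nat \<Rightarrow> real"
    and lat :: "'e \<Rightarrow> real \<Rightarrow> real"
  assumes no_cycle: "\<nexists>p. cycle p"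
    and finite_groups: "finite GE" "finite GI"
    and disjoint_groups: "GE \<inter> GI = {}"
    and route_exists: "g \<in> GE \<union> GI \<Longrightarrow> \<exists>p. apath (orig g) p (dest g)"
    and demand_nonneg: "g \<in> GE \<union> GI \<Longrightarrow> 0 \<le> d g"
    and vot_pos: "g \<in> GE \<union> GI \<Longrightarrow> t \<in> {1..T} \<Longrightarrow> 0 < v g t"
    and latency_strict_mono: "e \<in> arcs N \<Longrightarrow> strict_mono_on {0..} (lat e)"
    and latency_convex: "e \<in> arcs N \<Longrightarrow> convex_on {0..} (lat e)"
    and latency_nonneg: "e \<in> arcs N \<Longrightarrow> 0 \<le> x \<Longrightarrow> 0 \<le> lat e x"
begin

definition groups :: "'g set" where
  "groups = GE \<union> GI"

definition groups_on :: "'e \<Rightarrow> 'g set" where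
  "groups_on e = {g \<in> groups. \<exists>p. apath (orig g) p (dest g) \<and> e \<in> set p}"

definition edges_of :: "'g \<Rightarrow> 'e set" where
  "edges_of g = {e \<in> arcs N. g \<in> groups_on e}"

definition flow_index :: "('e \<times> nat \<times> nat \<times> 'g) set" where
  "flow_index = {(e, k, t, g). e \<in> arcs N \<and> k \<in> {1, 2} \<and> t \<in> {1..T} \<and> g \<in> groups_on e}"

definition flows :: "('e \<times> nat \<times> nat \<times> 'g \<Rightarrow> real) set" where
  "flows = flow_index \<rightarrow>\<^sub>E {0..}"

definition admissible_flows :: "('e \<times> nat \<times> nat \<times> 'g \<Rightarrow> real) set" where
  "admissible_flows = {y \<in> flows. \<forall>i\<in>verts N. \<forall>g\<in>groups. \<forall>t\<in>{1..T}.
      (if i = orig g then d g else 0) + (\<Sum>e\<in>in_arcs N i \<inter> edges_of g. \<Sum>k\<in>{1, 2}. y (e, k, t, g))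
    = (if i = dest g then d g else 0) + (\<Sum>e\<in>out_arcs N i \<inter> edges_of g. \<Sum>k\<in>{1, 2}. y (e, k, t, g))}"

definition lane_flow :: "('e \<times> nat \<times> nat \<times> 'g \<Rightarrow> real) \<Rightarrow> 'e \<Rightarrow> nat \<Rightarrow> nat \<Rightarrow> real" where
  "lane_flow y e k t = (\<Sum>g\<in>groups_on e. y (e, k, t, g))"

definition feasible_flows ::
    "('e \<Rightarrow> nat \<Rightarrow> real) \<Rightarrow> ('g \<Rightarrow> real) \<Rightarrow> ('e \<times> nat \<times> nat \<times> 'g \<Rightarrow> real) set" where
  "feasible_flows \<tau> B = {y \<in> admissible_flows.
     \<forall>g\<in>GE. (\<Sum>t\<in>{1..T}. \<Sum>e\<in>edges_of g. y (e, 1, t, g) * \<tau> e t) \<le> B g}"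

definition cost :: "('e \<Rightarrow> nat \<Rightarrow> real) \<Rightarrow> ('e \<times> nat \<times> nat \<times> 'g \<Rightarrow> real)
    \<Rightarrow> 'e \<Rightarrow> nat \<Rightarrow> nat \<Rightarrow> 'g \<Rightarrow> real" where
  "cost \<tau> y e k t g =
     (if k = 1 \<and> g \<in> GI then v g t * lat e (lane_flow y e 1 t) + \<tau> e t
      else v g t * lat e (lane_flow y e k t))"

definition cbcp_equilibria ::
    "('e \<Rightarrow> nat \<Rightarrow> real) \<Rightarrow> ('g \<Rightarrow> real) \<Rightarrow> ('e \<times> nat \<times> nat \<times> 'g \<Rightarrow> real) set" where
  "cbcp_equilibria \<tau> B = {ys \<in> feasible_flows \<tau> B. \<forall>g\<in>groups. \<forall>y\<in>feasible_flows \<tau> B.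
     0 \<le> (\<Sum>e\<in>edges_of g. \<Sum>k\<in>{1, 2}. \<Sum>t\<in>{1..T}.
            (y (e, k, t, g) - ys (e, k, t, g)) * cost \<tau> ys e k t g)}"

end

end

theory Submission
  imports Defs
begin

text \<open>
  An equilibrium is a solution of the variational inequality of the cost map over the feasible set:
  the constraints decouple over the groups, so deviations of a single group can be tested separately.
  The feasible set is convex, and compact because acyclicity bounds every edge flow; the cost map is
  continuous because a convex increasing function on the half-line has no jump at the endpoint.
  Since costs are weighted by group-dependent values of time, there is no potential to minimise and
  a fixed-point argument is needed. The dimension is a number, not a type, so Brouwer's theorem is
  derived for \<open>[0,1]\<^sup>n\<close> from Kuhn's combinatorial lemma. It yields, for any finitely many test flows, a
  convex combination of them satisfying those finitely many inequalities; compactness of the feasible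
  set then handles all test flows at once.
\<close>

section \<open>Brouwer's theorem and variational inequalities\<close>

lemma tendsto_fun_iff:
  fixes f :: "'b \<Rightarrow> 'i \<Rightarrow> 'c::topological_space"
  shows "(f \<longlongrightarrow> l) F \<longleftrightarrow> (\<forall>i. ((\<lambda>x. f x i) \<longlongrightarrow> l i) F)"
  using limitin_componentwise[of "\<lambda>_. euclidean :: 'c topology" UNIV f l F]
  by (simp add: euclidean_product_topology)

lemma continuous_on_coordinate [continuous_intros]:
  "continuous_on A (\<lambda>x. x i :: 'c::topological_space)"
  by (rule continuous_on_subset[OF continuous_on_product_coordinates subset_UNIV])

lemma compact_PiE:
  fixes S :: "'i \<Rightarrow> 'c::topological_space set"
  assumes "\<And>i. i \<in> I \<Longrightarrow> compact (S i)"
  shows "compact (PiE I S)"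
proof -
  \<comment> \<open>Outside \<open>I\<close> an extensional function is pinned to
    \<open>undefined\<close>, so the set is a full product with compact singleton factors there, and
    Tychonoff's theorem applies.\<close>
  have eq: "PiE I S = PiE UNIV (\<lambda>i. if i \<in> I then S i else {undefined})"
    by (auto simp: PiE_def Pi_def extensional_def split: if_splits)
  have "compactin (product_topology (\<lambda>_. euclidean) UNIV) (PiE I S)"
    unfolding eq compactin_PiE using assms by auto
  then show ?thesis
    by (simp add: euclidean_product_topology)
qed

text \<open>Products of Hausdorff spaces are Hausdorff, and there compact sets are closed. This
  later makes the solution set of a single inequality over a compact \<open>K\<close> closed in the
  whole space.\<close>

lemma compact_fun_imp_closed:
  fixes K :: "('i \<Rightarrow> 'c::t2_space) set"
  assumes "compact K"
  shows "closed K"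
proof -
  have "Hausdorff_space (product_topology (\<lambda>_. euclidean :: 'c topology) (UNIV :: 'i set))"
    unfolding Hausdorff_space_product_topology
    by (simp add: Hausdorff_space_def disjnt_def) (metis hausdorff)
  then have "Hausdorff_space (euclidean :: ('i \<Rightarrow> 'c) topology)"
    by (simp only: euclidean_product_topology)
  then show ?thesis
    using assms compactin_imp_closedin by (metis closed_closedin compactin_euclidean_iff)
qed

text \<open>Kuhn's lemma on a grid of mesh \<open>1 / Suc m\<close> gives a cell which, for each
  coordinate \<open>i\<close>, has one vertex where \<open>f\<close> does not decrease coordinate
  \<open>i\<close> and one where \<open>f\<close> does not increase it. Along a subsequence the
  cells shrink to a point \<open>l\<close>, and continuity turns the two inequalities into
  \<open>f l i = l i\<close>.\<close>

lemma brouwer_unit_cube_PiE: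
  fixes f :: "(nat \<Rightarrow> real) \<Rightarrow> nat \<Rightarrow> real" and n :: nat
  defines "C \<equiv> {..<n} \<rightarrow>\<^sub>E {0..1}"
  assumes cont: "\<And>i. i < n \<Longrightarrow> continuous_on C (\<lambda>x. f x i)"
    and ran: "\<And>x i. x \<in> C \<Longrightarrow> i < n \<Longrightarrow> f x i \<in> {0..1}"
  shows "\<exists>x\<in>C. \<forall>i<n. f x i = x i"
proof -
  define near where "near \<epsilon> x a \<longleftrightarrow> a \<in> C \<and> (\<forall>j<n. \<bar>a j - x j\<bar> \<le> \<epsilon>)" for \<epsilon> :: real and x a
  have approx: "\<exists>x\<in>C. \<forall>i<n. \<exists>a b. near (1 / Suc m) x a \<and> near (1 / Suc m) x b
      \<and> a i \<le> f a i \<and> f b i \<le> b i" for m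
  proof -
    define p where "p = Suc m"
    define pt where "pt q = (\<lambda>i\<in>{..<n}. real (q i) / real p)" for q
    \<comment> \<open>Label 0 means that \<open>f\<close> does not decrease coordinate
      \<open>i\<close> at the grid point, label 1 that it does not increase it. Kuhn's lemma
      prescribes 0 on the face \<open>q i = 0\<close> and 1 on the face \<open>q i = p\<close>; both
      agree with this meaning because \<open>f\<close> maps into the unit interval.\<close>
    define label where "label q i =
      (if q i = 0 \<or> q i \<noteq> p \<and> pt q i \<le> f (pt q) i then 0 else 1 :: nat)" for q i
    have p: "0 < p" by (simp add: p_def)
    have pt_C: "pt q \<in> C" if "\<forall>i<n. q i \<le> p" for q
      using that p by (auto simp: pt_def C_def)
    obtain q where q: "\<forall>i<n. q i < p"
      and lab: "\<forall>i<n. \<exists>r s. (\<forall>j<n. q j \<le> r j \<and> r j \<le> q j + 1) \<and>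
        (\<forall>j<n. q j \<le> s j \<and> s j \<le> q j + 1) \<and> label r i \<noteq> label s i"
      by (rule kuhn_lemma[OF p, of n label]) (use p in \<open>auto simp: label_def\<close>)
    have near_pt: "near (1 / Suc m) (pt q) (pt r)" if r: "\<forall>j<n. q j \<le> r j \<and> r j \<le> q j + 1" for r
      unfolding near_def
    proof (intro conjI allI impI)
      have "r i \<le> p" if "i < n" for i
        using r q that by (metis Suc_eq_plus1 Suc_leI le_trans)
      then show "pt r \<in> C" by (intro pt_C) auto
    next
      fix j assume j: "j < n"
      have "\<bar>real (r j) - real (q j)\<bar> \<le> 1"
        using r j by (auto simp: abs_le_iff)
      then show "\<bar>pt r j - pt q j\<bar> \<le> 1 / Suc m"
        using j divide_right_mono[of "\<bar>real (r j) - real (q j)\<bar>" 1 "real p"]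
        by (simp add: pt_def p_def abs_divide flip: diff_divide_distrib)
    qed
    have lab0: "pt r i \<le> f (pt r) i" if "i < n" "pt r \<in> C" "label r i = 0" for r i
      using that ran[of "pt r" i] by (auto simp: label_def pt_def split: if_splits)
    have lab1: "f (pt r) i \<le> pt r i" if "i < n" "pt r \<in> C" "label r i \<noteq> 0" for r i
      using that ran[of "pt r" i] p by (auto simp: label_def pt_def split: if_splits)
    show ?thesis
    proof (intro bexI allI impI)
      show "pt q \<in> C" using q by (intro pt_C) auto
      fix i assume i: "i < n"
      from lab i obtain r s where rs': "\<forall>j<n. q j \<le> r j \<and> r j \<le> q j + 1"
        "\<forall>j<n. q j \<le> s j \<and> s j \<le> q j + 1" "label r i \<noteq> label s i"
        by blast
      note rs = near_pt[OF rs'(1)] near_pt[OF rs'(2)] rs'(3)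
      from rs have C: "pt r \<in> C" "pt s \<in> C" by (auto simp: near_def)
      show "\<exists>a b. near (1 / Suc m) (pt q) a \<and> near (1 / Suc m) (pt q) b \<and> a i \<le> f a i \<and> f b i \<le> b i"
      proof (cases "label r i = 0")
        case True
        then show ?thesis using rs lab0[OF i C(1)] lab1[OF i C(2)] by auto
      next
        case False
        then have "label s i = 0" using rs by (auto simp: label_def split: if_splits)
        then show ?thesis using False rs lab0[OF i C(2)] lab1[OF i C(1)] by auto
      qed
    qed
  qed
  obtain X where X: "\<And>m. X m \<in> C" "\<And>m. \<forall>i<n. \<exists>a b. near (1 / Suc m) (X m) a
      \<and> near (1 / Suc m) (X m) b \<and> a i \<le> f a i \<and> f b i \<le> b i"
    using approx by metis
  obtain a b where ab: "\<And>m i. i < n \<Longrightarrow> near (1 / Suc m) (X m) (a m i)"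
      "\<And>m i. i < n \<Longrightarrow> near (1 / Suc m) (X m) (b m i)"
      "\<And>m i. i < n \<Longrightarrow> a m i i \<le> f (a m i) i" "\<And>m i. i < n \<Longrightarrow> f (b m i) i \<le> b m i i"
  proof -
    \<comment> \<open>The two vertices are packed into a pair, so that choosing over
      \<open>m\<close> and \<open>i\<close> yields both sequences at once.\<close>
    have "\<forall>m. \<forall>i. \<exists>c. i < n \<longrightarrow> near (1 / Suc m) (X m) (fst c) \<and> near (1 / Suc m) (X m) (snd c)
        \<and> fst c i \<le> f (fst c) i \<and> f (snd c) i \<le> snd c i"
      using X(2) by simp
    then obtain c where "\<forall>m i. i < n \<longrightarrow> near (1 / Suc m) (X m) (fst (c m i))
        \<and> near (1 / Suc m) (X m) (snd (c m i))
        \<and> fst (c m i) i \<le> f (fst (c m i)) i \<and> f (snd (c m i)) i \<le> snd (c m i) i"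
      unfolding choice_iff by blast
    then show ?thesis
      by (intro that[of "\<lambda>m i. fst (c m i)" "\<lambda>m i. snd (c m i)"]) auto
  qed
  have "compact C" unfolding C_def by (intro compact_PiE) auto
  then obtain l r where l: "l \<in> C" and r: "strict_mono r" and lim: "(X \<circ> r) \<longlonglongrightarrow> l"
    using X(1) unfolding compact_def by metis
  have lim0: "(\<lambda>m. 1 / real (Suc (r m))) \<longlonglongrightarrow> 0"
    using LIMSEQ_subseq_LIMSEQ[OF LIMSEQ_Suc[OF lim_inverse_n'] r] by (simp add: o_def)
  \<comment> \<open>Any selection of vertices from the shrinking cells has the same limit as the
    base points \<open>X\<close>.\<close>
  have near_lim: "(\<lambda>m. c (r m)) \<longlonglongrightarrow> l" if c: "\<And>m. near (1 / Suc m) (X m) (c m)" for c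
    unfolding tendsto_fun_iff
  proof
    fix j
    show "(\<lambda>m. c (r m) j) \<longlonglongrightarrow> l j"
    proof (cases "j < n")
      case True
      have "(\<lambda>m. c (r m) j - X (r m) j) \<longlonglongrightarrow> 0"
        using c True by (intro Lim_null_comparison[OF _ lim0] always_eventually) (auto simp: near_def)
      moreover have "(\<lambda>m. X (r m) j) \<longlonglongrightarrow> l j"
        using lim by (simp add: tendsto_fun_iff o_def)
      ultimately have "(\<lambda>m. (c (r m) j - X (r m) j) + X (r m) j) \<longlonglongrightarrow> 0 + l j"
        by (rule tendsto_add)
      then show ?thesis by simp
    next
      case False
      \<comment> \<open>Both functions are extensional, so off the index set they share the value
        \<open>undefined\<close>.\<close>
      then have "c (r m) j = l j" for m
        using c[of "r m"] l by (simp add: near_def C_def PiE_def extensional_def)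
      then show ?thesis by simp
    qed
  qed
  have f_lim: "(\<lambda>m. f (c (r m)) i) \<longlonglongrightarrow> f l i"
    if c: "\<And>m. near (1 / Suc m) (X m) (c m)" and i: "i < n" for c i
    using continuous_on_tendsto_compose[OF cont[OF i] near_lim[OF c] l] c by (simp add: near_def)
  have "f l i = l i" if i: "i < n" for i
  proof (rule antisym)
    have "(\<lambda>m. b (r m) i i) \<longlonglongrightarrow> l i"
      using near_lim[OF ab(2)[OF i]] by (simp add: tendsto_fun_iff)
    with f_lim[OF ab(2)[OF i] i] show "f l i \<le> l i"
      by (rule LIMSEQ_le) (use ab(4)[OF i] in auto)
    have "(\<lambda>m. a (r m) i i) \<longlonglongrightarrow> l i"
      using near_lim[OF ab(1)[OF i]] by (simp add: tendsto_fun_iff)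
    from this f_lim[OF ab(1)[OF i] i] show "l i \<le> f l i"
      by (rule LIMSEQ_le) (use ab(3)[OF i] in auto)
  qed
  with l show ?thesis by auto
qed

text \<open>A fixed point of Nash's map, which shifts weight towards the indices with \<open>G w i < 0\<close>.\<close>

lemma simplex_complementarity:
  fixes G :: "(nat \<Rightarrow> real) \<Rightarrow> nat \<Rightarrow> real" and n :: nat
  defines "\<Delta> \<equiv> {w \<in> {..<n} \<rightarrow>\<^sub>E {0..1}. (\<Sum>i<n. w i) = 1}"
  assumes n: "0 < n"
    and cont: "\<And>i. i < n \<Longrightarrow> continuous_on \<Delta> (\<lambda>w. G w i)"
    and orth: "\<And>w. w \<in> \<Delta> \<Longrightarrow> (\<Sum>i<n. w i * G w i) = 0"
  shows "\<exists>w\<in>\<Delta>. \<forall>i<n. 0 \<le> G w i"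
proof -
  define C :: "(nat \<Rightarrow> real) set" where "C = {..<n} \<rightarrow>\<^sub>E {0..1}"
  \<comment> \<open>\<open>R\<close> retracts the cube onto the simplex: a deficit of the coordinate
    sum below 1 is spread evenly over the \<open>n\<close> coordinates, an excess is scaled away.
    Brouwer's theorem on the cube can then be applied to \<open>nash\<close> after
    \<open>R\<close>.\<close>
  define R where "R x = (\<lambda>i\<in>{..<n}. (x i + max 0 (1 - (\<Sum>j<n. x j)) / n) / max 1 (\<Sum>j<n. x j))"
    for x :: "nat \<Rightarrow> real"
  define h where "h w i = max 0 (- G w i)" for w i
  define nash where "nash w i = (w i + h w i) / (1 + (\<Sum>j<n. h w j))" for w i
  have le1: "w i \<le> 1" if "\<And>i. i < n \<Longrightarrow> 0 \<le> w i" "(\<Sum>i<n. w i) = 1" "i < n" for w :: "nat \<Rightarrow> real" and i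
    using member_le_sum[of i "{..<n}" w] that by auto
  have R: "R x \<in> \<Delta>" if x: "x \<in> C" for x
  proof -
    have pos: "0 \<le> R x i" if i: "i < n" for i
    proof -
      have "0 \<le> x i" using PiE_mem[OF x[unfolded C_def], of i] i by simp
      then have "0 \<le> (x i + max 0 (1 - (\<Sum>j<n. x j)) / n) / max 1 (\<Sum>j<n. x j)"
        by (intro divide_nonneg_nonneg add_nonneg_nonneg) simp_all
      then show ?thesis using i by (simp add: R_def)
    qed
    have "(\<Sum>i<n. R x i) = ((\<Sum>i<n. x i) + max 0 (1 - (\<Sum>j<n. x j))) / max 1 (\<Sum>j<n. x j)"
      using n by (simp add: R_def sum.distrib flip: sum_divide_distrib)
    also have "\<dots> = 1" by (auto simp: max_def)
    finally show ?thesis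
      using pos le1[of "R x"] by (auto simp: \<Delta>_def R_def)
  qed
  have R_id: "R x = x" if "x \<in> \<Delta>" for x
  proof
    show "R x i = x i" for i
      using that by (simp add: R_def \<Delta>_def PiE_def extensional_def)
  qed
  have h_nonneg: "0 \<le> h w i" for w i by (simp add: h_def)
  then have den: "0 < 1 + (\<Sum>j<n. h w j)" for w
    by (smt (verit) sum_nonneg)
  have nash_nonneg: "0 \<le> nash w i" if "w \<in> \<Delta>" "i < n" for w i
    using that h_nonneg[of w i] less_imp_le[OF den[of w]] by (auto simp: nash_def \<Delta>_def PiE_iff)
  have nash_sum: "(\<Sum>i<n. nash w i) = 1" if "w \<in> \<Delta>" for w
    using that den[of w] by (simp add: nash_def sum.distrib \<Delta>_def flip: sum_divide_distrib)
  have R_cont: "continuous_on C R"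
    unfolding R_def
  proof (intro continuous_on_coordinatewise_then_product)
    fix i
    have "max 1 s \<noteq> 0" for s :: real by simp
    then show "continuous_on C (\<lambda>x. (\<lambda>i\<in>{..<n}. (x i + max 0 (1 - (\<Sum>j<n. x j)) / real n) / max 1 (\<Sum>j<n. x j)) i)"
      using n by (cases "i < n") (auto intro!: continuous_intros)
  qed
  have nash_cont: "continuous_on C (\<lambda>x. nash (R x) i)" if i: "i < n" for i
  proof -
    have [continuous_intros]: "continuous_on C (\<lambda>x. G (R x) j)" if "j < n" for j
      using continuous_on_compose2[OF cont[OF that] R_cont] R by auto
    have [continuous_intros]: "continuous_on C (\<lambda>x. R x j)" for j :: nat
      using R_cont by (rule continuous_on_product_then_coordinatewise)
    show ?thesis
      unfolding nash_def using i den
      by (intro continuous_intros) (auto simp: h_def less_imp_neq[THEN not_sym] intro!: continuous_intros)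
  qed
  have "\<exists>x\<in>C. \<forall>i<n. nash (R x) i = x i"
    unfolding C_def
  proof (rule brouwer_unit_cube_PiE)
    show "continuous_on ({..<n} \<rightarrow>\<^sub>E {0..1}) (\<lambda>x. nash (R x) i)" if "i < n" for i
      using nash_cont[OF that] by (simp add: C_def)
    show "nash (R x) i \<in> {0..1}" if "x \<in> {..<n} \<rightarrow>\<^sub>E {0..1}" "i < n" for x i
      using that R[of x] nash_nonneg[of "R x"] nash_sum[of "R x"] le1[of "nash (R x)" i]
      by (auto simp: C_def)
  qed
  then obtain w where w: "w \<in> C" "\<And>i. i < n \<Longrightarrow> nash (R w) i = w i" by auto
  \<comment> \<open>The fixed point is a value of \<open>nash\<close>, and these have coordinate sum
    1; hence \<open>R\<close> leaves it unchanged.\<close>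
  have w\<Delta>: "w \<in> \<Delta>"
    using w nash_sum[OF R[OF w(1)]] by (simp add: \<Delta>_def C_def)
  define H where "H = (\<Sum>j<n. h w j)"
  have fp: "h w i = w i * H" if "i < n" for i
    using w(2)[OF that] den[of w] R_id[OF w\<Delta>] by (simp add: nash_def H_def field_simps)
  \<comment> \<open>By \<open>fp\<close>, \<open>h w\<close> is \<open>H\<close> times
    \<open>w\<close>. If \<open>H\<close> were positive, every index of positive weight would have
    \<open>G w j < 0\<close>, and the weighted sum would be negative, against
    \<open>orth\<close>.\<close>
  have "h w i = 0" if i: "i < n" for i
  proof (rule ccontr)
    assume "h w i \<noteq> 0"
    then have H: "0 < H" 
      using fp[OF i] h_nonneg[of w] by (metis H_def less_eq_real_def mult_zero_right sum_nonneg)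
    have wi: "0 < w i"
      using \<open>h w i \<noteq> 0\<close> fp[OF i] w(1) i by (auto simp: C_def PiE_iff less_le)
    have neg: "w j * G w j \<le> 0 \<and> (0 < w j \<longrightarrow> w j * G w j < 0)" if j: "j < n" for j
    proof (cases "w j = 0")
      case False
      then have "0 < w j" using w(1) j by (auto simp: C_def PiE_iff less_le)
      moreover from this have "0 < h w j" using fp[OF j] H by simp
      then have "G w j < 0" by (simp add: h_def max_def split: if_splits)
      ultimately show ?thesis by (simp add: mult_pos_neg less_imp_le)
    qed simp
    have "(\<Sum>j<n. w j * G w j) < (\<Sum>j<n. 0)"
      using neg wi i by (intro sum_strict_mono_ex1) auto
    then show False using orth[OF w\<Delta>] by simp
  qed
  then have "0 \<le> G w i" if "i < n" for i
    using that by (metis h_def max.cobounded2 neg_le_0_iff_le)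
  with w\<Delta> show ?thesis by blast
qed

section \<open>Variational inequalities over compact convex sets\<close>

lemma convex_fun_sum:
  fixes K :: "('i \<Rightarrow> real) set" and w :: "'j \<Rightarrow> real"
  assumes conv: "\<forall>x\<in>K. \<forall>y\<in>K. \<forall>u\<in>{0..1}. (\<lambda>i. u * x i + (1 - u) * y i) \<in> K"
    and "finite J" "\<And>j. j \<in> J \<Longrightarrow> 0 \<le> w j" "sum w J = 1" "\<And>j. j \<in> J \<Longrightarrow> y j \<in> K"
  shows "(\<lambda>i. \<Sum>j\<in>J. w j * y j i) \<in> K"
  using assms(2-)
proof (induction J arbitrary: w rule: finite_induct)
  case empty
  then show ?case by simp
next
  case (insert a J)
  show ?case
  proof (cases "sum w J = 0")
    case True
    then have "\<forall>j\<in>J. w j = 0"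
      using insert by (simp add: sum_nonneg_eq_0_iff)
    then show ?thesis
      using insert True by simp
  next
    case False
    \<comment> \<open>Division by \<open>s\<close> makes the remaining weights sum to 1, as the
      induction hypothesis requires; the new point keeps the weight \<open>1 - s\<close>.\<close>
    define s where "s = sum w J"
    have s: "0 < s" "w a = 1 - s"
      using False insert by (auto simp: s_def less_le sum_nonneg)
    have "(\<lambda>i. \<Sum>j\<in>J. w j / s * y j i) \<in> K"
      using insert s by (intro insert.IH) (auto simp: s_def simp flip: sum_divide_distrib)
    moreover have "y a \<in> K" "w a \<in> {0..1}"
      using insert.prems(1)[of a] insert.prems(3)[of a] s by auto
    ultimately have "(\<lambda>i. w a * y a i + (1 - w a) * (\<Sum>j\<in>J. w j / s * y j i)) \<in> K"
      using conv[rule_format, of "y a" "\<lambda>i. \<Sum>j\<in>J. w j / s * y j i" "w a"] by simp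
    then show ?thesis
      using insert.hyps s by (simp add: sum_distrib_left)
  qed
qed

text \<open>This is the Hartman-Stampacchia theorem, with \<open>I\<close> the finite set of
  coordinates that enter the pairing.\<close>

lemma variational_inequality_compact_convex:
  fixes K :: "('i \<Rightarrow> real) set" and F :: "('i \<Rightarrow> real) \<Rightarrow> 'i \<Rightarrow> real"
  assumes "compact K" "K \<noteq> {}" "finite I"
    and conv: "\<forall>x\<in>K. \<forall>y\<in>K. \<forall>u\<in>{0..1}. (\<lambda>i. u * x i + (1 - u) * y i) \<in> K"
    and cont: "\<And>i. i \<in> I \<Longrightarrow> continuous_on K (\<lambda>x. F x i)"
  shows "\<exists>x\<in>K. \<forall>y\<in>K. 0 \<le> (\<Sum>i\<in>I. (y i - x i) * F x i)"
proof -
  define S where "S y = {x \<in> K. 0 \<le> (\<Sum>i\<in>I. (y i - x i) * F x i)}" for y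
  have closed: "closed (S y)" for y
  proof -
    have "continuous_on K (\<lambda>x. \<Sum>i\<in>I. (y i - x i) * F x i)"
      by (intro continuous_intros cont)
    from continuous_closed_preimage[OF this compact_fun_imp_closed[OF \<open>compact K\<close>], of "{0..}"]
    show ?thesis by (simp add: S_def vimage_def Int_def)
  qed
  \<comment> \<open>The sets \<open>S y\<close> are closed, so by the finite intersection property a
    common point for finitely many test points is enough.\<close>
  have fin: "K \<inter> (\<Inter>y\<in>Y. S y) \<noteq> {}" if Y: "finite Y" "Y \<subseteq> K" for Y
  proof (cases "Y = {}")
    case True
    then show ?thesis using \<open>K \<noteq> {}\<close> by simp
  next
    case False
    define n where "n = card Y"
    obtain y where y: "bij_betw y {..<n} Y"
      using ex_bij_betw_nat_finite[OF Y(1)] by (auto simp: n_def atLeast0LessThan)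
    have yK: "y j \<in> K" if "j < n" for j
      using y that Y(2) by (auto simp: bij_betw_def)
    define \<Delta> where "\<Delta> = {w \<in> {..<n} \<rightarrow>\<^sub>E {0..1::real}. (\<Sum>i<n. w i) = 1}"
    define c where "c w = (\<lambda>i. \<Sum>j<n. w j * y j i)" for w
    \<comment> \<open>\<open>G w j\<close> is the left side of the inequality for the test point
      \<open>y j\<close> at the barycentre \<open>c w\<close>. Deviations from the barycentre cancel
      under the weights \<open>w\<close>, which is the orthogonality that
      \<open>simplex_complementarity\<close> asks for.\<close>
    define G where "G w j = (\<Sum>i\<in>I. (y j i - c w i) * F (c w) i)" for w j
    have c: "c w \<in> K" if "w \<in> \<Delta>" for w
      unfolding c_def using that yK by (intro convex_fun_sum[OF conv]) (auto simp: \<Delta>_def PiE_iff)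
    have c_cont: "continuous_on \<Delta> c"
      unfolding c_def
      by (intro continuous_on_coordinatewise_then_product continuous_intros)
    have "\<exists>w\<in>\<Delta>. \<forall>j<n. 0 \<le> G w j"
      unfolding \<Delta>_def
    proof (rule simplex_complementarity, fold \<Delta>_def)
      show "0 < n" using False Y by (simp add: n_def card_gt_0_iff)
      show "continuous_on \<Delta> (\<lambda>w. G w j)" for j
        unfolding G_def
      proof (intro continuous_intros)
        show "continuous_on \<Delta> (\<lambda>w. c w i)" for i
          using c_cont by (rule continuous_on_product_then_coordinatewise)
        show "continuous_on \<Delta> (\<lambda>w. F (c w) i)" if "i \<in> I" for i
          using c continuous_on_compose2[OF cont[OF that] c_cont] by auto
      qed
      show "(\<Sum>j<n. w j * G w j) = 0" if w: "w \<in> \<Delta>" for w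
      proof -
        have "(\<Sum>j<n. w j * G w j) = (\<Sum>i\<in>I. \<Sum>j<n. w j * ((y j i - c w i) * F (c w) i))"
          unfolding G_def sum_distrib_left by (rule sum.swap)
        also have "\<dots> = (\<Sum>i\<in>I. ((\<Sum>j<n. w j * y j i) - (\<Sum>j<n. w j) * c w i) * F (c w) i)"
          by (simp add: algebra_simps sum_subtractf sum_distrib_left sum_distrib_right)
        also have "\<dots> = 0"
          using w by (simp add: \<Delta>_def c_def)
        finally show ?thesis .
      qed
    qed
    then obtain w where w: "w \<in> \<Delta>" "\<And>j. j < n \<Longrightarrow> 0 \<le> G w j" by auto
    have "c w \<in> S z" if "z \<in> Y" for z
    proof -
      obtain j where "j < n" "z = y j" using y \<open>z \<in> Y\<close> by (auto simp: bij_betw_def)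
      then show ?thesis using w c by (auto simp: S_def G_def)
    qed
    then show ?thesis using c[OF w(1)] by auto
  qed
  have "K \<inter> (\<Inter>y\<in>K. S y) \<noteq> {}"
    by (rule compact_imp_fip_image[OF \<open>compact K\<close> closed fin])
  then show ?thesis by (auto simp: S_def)
qed

text \<open>On the open half-line convexity suffices. At the endpoint it would still allow
  \<open>f a\<close> to exceed the limit from the right; monotonicity bounds \<open>f\<close> below
  by \<open>f a\<close>, and the chord to \<open>a + 1\<close> bounds it above.\<close>

lemma convex_mono_continuous_on_atLeast:
  fixes f :: "real \<Rightarrow> real"
  assumes "convex_on {a..} f" "mono_on {a..} f"
  shows "continuous_on {a..} f"
  unfolding continuous_on_eq_continuous_within
proof
  fix x assume "x \<in> {a..}"
  show "continuous (at x within {a..}) f"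
  proof (cases "x = a")
    case False
    with \<open>x \<in> {a..}\<close> have x: "x \<in> {a<..}" by auto
    have "convex_on {a<..} f"
      using assms(1) by (rule convex_on_subset) auto
    then have "continuous_on {a<..} f"
      by (intro convex_on_continuous) auto
    then show ?thesis
      using x by (simp add: continuous_on_eq_continuous_at continuous_at_imp_continuous_at_within)
  next
    case True
    have ev: "\<forall>\<^sub>F z in at a within {a..}. z \<in> {a..a + 1}"
      unfolding eventually_at by (intro exI[of _ 1]) (auto simp: dist_real_def)
    have "(f \<longlongrightarrow> f a) (at a within {a..})"
    proof (rule real_tendsto_sandwich)
      show "\<forall>\<^sub>F z in at a within {a..}. f a \<le> f z"
        using ev by eventually_elim (auto intro!: mono_onD[OF assms(2)])
      show "\<forall>\<^sub>F z in at a within {a..}. f z \<le> (1 - (z - a)) * f a + (z - a) * f (a + 1)"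
        using ev
      proof eventually_elim
        case (elim z)
        have "(1 - (z - a)) * a + (z - a) * (a + 1) = z"
          by (simp add: algebra_simps)
        then show ?case
          using convex_onD[OF assms(1), of "z - a" a "a + 1"] elim by simp
      qed
      show "((\<lambda>z. (1 - (z - a)) * f a + (z - a) * f (a + 1)) \<longlongrightarrow> f a) (at a within {a..})"
        by (auto intro!: tendsto_eq_intros)
    qed (rule tendsto_const)
    with True show ?thesis by (simp add: continuous_within)
  qed
qed

section \<open>Flows on acyclic networks\<close>

text \<open>The potential of a vertex is the number of vertices from which it can be reached. Along
  an arc this set can only grow, and it gains the head itself, since a walk back to the tail would
  close a cycle.\<close>

lemma (in fin_digraph) acyclic_potential:
  assumes "\<nexists>p. cycle p"
  obtains \<pi> :: "'a \<Rightarrow> nat" where "\<And>e. e \<in> arcs G \<Longrightarrow> \<pi> (tail G e) < \<pi> (head G e)"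
proof
  fix e assume e: "e \<in> arcs G"
  let ?anc = "\<lambda>v. {u \<in> verts G. u \<rightarrow>\<^sup>*\<^bsub>G\<^esub> v}"
  have step: "tail G e \<rightarrow>\<^sup>*\<^bsub>G\<^esub> head G e"
    using e by (meson in_arcs_imp_in_arcs_ends reachable_adjI)
  have "\<not> head G e \<rightarrow>\<^sup>*\<^bsub>G\<^esub> tail G e"
  proof
    assume "head G e \<rightarrow>\<^sup>*\<^bsub>G\<^esub> tail G e"
    then obtain p where "awalk (head G e) p (tail G e)"
      by (auto simp: reachable_awalk)
    then have "awalk (tail G e) (e # p) (tail G e)"
      using e by (simp add: awalk_Cons_iff)
    then have "closed_w (e # p)"
      by (auto simp: closed_w_def)
    then show False using closed_w_imp_cycle assms by blast
  qed
  then have "head G e \<in> ?anc (head G e) - ?anc (tail G e)"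
    using e by (auto simp: head_in_verts)
  moreover have "?anc (tail G e) \<subseteq> ?anc (head G e)"
    using step reachable_trans by auto
  ultimately show "card (?anc (tail G e)) < card (?anc (head G e))"
    by (intro psubset_card_mono) auto
qed

text \<open>Sending the amount \<open>c\<close> along a walk conserves flow, by telescoping: each
  arc ends where the next one starts. The list sums count an arc as often as the walk uses
  it.\<close>

lemma (in wf_digraph) awalk_conservation:
  assumes "awalk u p v"
  shows "(if i = u then c else 0) + (\<Sum>e\<leftarrow>p. if head G e = i then c else 0)
    = (if i = v then c else 0) + (\<Sum>e\<leftarrow>p. if tail G e = i then c else (0::real))"
  using assms proof (induction p arbitrary: u)
  case (Cons a p)
  then have "u = tail G a" "awalk (head G a) p v"
    by (auto simp: awalk_Cons_iff)
  with Cons.IH[of "head G a"] show ?case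
    by (simp add: eq_commute[of i])
qed (simp add: awalk_Nil_iff)

section \<open>Index sets and constraints of the network\<close>

context cbcp_network
begin

lemma finite_groups_all: "finite groups"
  using finite_groups by (simp add: groups_def)

lemma finite_edges_of: "finite (edges_of g)"
  by (simp add: edges_of_def)

lemma finite_flow_index: "finite flow_index"
proof -
  have "flow_index \<subseteq> arcs N \<times> {1, 2} \<times> {1..T} \<times> groups"
    by (auto simp: flow_index_def groups_on_def)
  then show ?thesis
    by (rule finite_subset) (simp add: finite_groups_all)
qed

lemma edges_of_subset_arcs: "edges_of g \<subseteq> arcs N"
  by (auto simp: edges_of_def)

lemma flow_nonneg: "y \<in> flows \<Longrightarrow> x \<in> flow_index \<Longrightarrow> 0 \<le> y x"
  by (auto simp: flows_def PiE_iff)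

lemma conservation:
  assumes "y \<in> admissible_flows" "i \<in> verts N" "g \<in> groups" "t \<in> {1..T}"
  shows "(if i = orig g then d g else 0) + (\<Sum>e\<in>in_arcs N i \<inter> edges_of g. \<Sum>k\<in>{1, 2}. y (e, k, t, g))
    = (if i = dest g then d g else 0) + (\<Sum>e\<in>out_arcs N i \<inter> edges_of g. \<Sum>k\<in>{1, 2}. y (e, k, t, g))"
  using assms unfolding admissible_flows_def by blast

lemma budget_constraint:
  assumes "y \<in> feasible_flows \<tau> B" "g \<in> GE"
  shows "(\<Sum>t\<in>{1..T}. \<Sum>e\<in>edges_of g. y (e, 1, t, g) * \<tau> e t) \<le> B g"
  using assms unfolding feasible_flows_def by blast

lemma feasible_imp_admissible: "y \<in> feasible_flows \<tau> B \<Longrightarrow> y \<in> admissible_flows"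
  by (simp add: feasible_flows_def)

lemma flow_index_edges_of:
  "(e, k, t, g) \<in> flow_index \<longleftrightarrow> e \<in> edges_of g \<and> k \<in> {1, 2} \<and> t \<in> {1..T}"
  by (auto simp: flow_index_def edges_of_def)

section \<open>Bounding edge flows by a potential\<close>

lemma sum_edges_by_head:
  "(\<Sum>i\<in>verts N. \<Sum>e\<in>in_arcs N i \<inter> edges_of g. f e) = (\<Sum>e\<in>edges_of g. f e)"
proof -
  have "in_arcs N i \<inter> edges_of g = {e \<in> edges_of g. head N e = i}" for i
    using edges_of_subset_arcs[of g] by auto
  moreover have "head N ` edges_of g \<subseteq> verts N"
    by (auto simp: edges_of_def)
  ultimately show ?thesis
    using sum.group[OF finite_edges_of finite_verts, of "head N" g f] by simp
qed

lemma sum_edges_by_tail: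
  "(\<Sum>i\<in>verts N. \<Sum>e\<in>out_arcs N i \<inter> edges_of g. f e) = (\<Sum>e\<in>edges_of g. f e)"
proof -
  have "out_arcs N i \<inter> edges_of g = {e \<in> edges_of g. tail N e = i}" for i
    using edges_of_subset_arcs[of g] by auto
  moreover have "tail N ` edges_of g \<subseteq> verts N"
    by (auto simp: edges_of_def)
  ultimately show ?thesis
    using sum.group[OF finite_edges_of finite_verts, of "tail N" g f] by simp
qed

text \<open>Weighting the conservation law at \<open>i\<close> by \<open>\<pi> i\<close> and summing over the nodes charges every
  unit of flow on \<open>e\<close> with \<open>\<pi> (head e) - \<pi> (tail e) \<ge> 1\<close>.\<close>

lemma flow_bound:
  fixes \<pi> :: "'i \<Rightarrow> nat"
  assumes \<pi>: "\<And>e. e \<in> arcs N \<Longrightarrow> \<pi> (tail N e) < \<pi> (head N e)"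
    and y: "y \<in> admissible_flows" and x: "(e, k, t, g) \<in> flow_index"
  shows "y (e, k, t, g) \<le> d g * \<pi> (dest g)"
proof -
  have g: "g \<in> groups" and e: "e \<in> edges_of g" and k: "k \<in> {1, 2}" and t: "t \<in> {1..T}"
    using x by (auto simp: flow_index_def edges_of_def groups_on_def)
  define f where "f a = (\<Sum>k\<in>{1, 2}. y (a, k, t, g))" for a
  have yk: "0 \<le> y (a, k, t, g)" if "a \<in> edges_of g" "k \<in> {1, 2}" for a k
    using y that t by (intro flow_nonneg) (auto simp: admissible_flows_def flow_index_edges_of)
  have f_nonneg: "0 \<le> f a" if "a \<in> edges_of g" for a
    unfolding f_def using yk[OF that] by (intro sum_nonneg)
  have verts: "orig g \<in> verts N" "dest g \<in> verts N"
    using route_exists[of g] g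
    by (auto simp: groups_def apath_def dest: awalk_hd_in_verts awalk_last_in_verts)
  have cons: "(if i = orig g then d g else 0) + (\<Sum>a\<in>in_arcs N i \<inter> edges_of g. f a)
      = (if i = dest g then d g else 0) + (\<Sum>a\<in>out_arcs N i \<inter> edges_of g. f a)" if "i \<in> verts N" for i
    unfolding f_def using y that g t by (rule conservation)
  have "(\<Sum>i\<in>verts N. \<pi> i * ((if i = orig g then d g else 0) + (\<Sum>a\<in>in_arcs N i \<inter> edges_of g. f a)))
      = (\<Sum>i\<in>verts N. \<pi> i * ((if i = dest g then d g else 0) + (\<Sum>a\<in>out_arcs N i \<inter> edges_of g. f a)))"
    using cons by (intro sum.cong) auto
  moreover have "(\<Sum>i\<in>verts N. \<pi> i * (\<Sum>a\<in>in_arcs N i \<inter> edges_of g. f a))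
      = (\<Sum>a\<in>edges_of g. \<pi> (head N a) * f a)"
    unfolding sum_distrib_left sum_edges_by_head[symmetric] by (intro sum.cong) auto
  moreover have "(\<Sum>i\<in>verts N. \<pi> i * (\<Sum>a\<in>out_arcs N i \<inter> edges_of g. f a))
      = (\<Sum>a\<in>edges_of g. \<pi> (tail N a) * f a)"
    unfolding sum_distrib_left sum_edges_by_tail[symmetric] by (intro sum.cong) auto
  moreover have "(\<Sum>i\<in>verts N. \<pi> i * (if i = j then d g else 0)) = \<pi> j * d g" if "j \<in> verts N" for j
    using that by (simp add: if_distrib cong: if_cong)
  ultimately have eq: "\<pi> (orig g) * d g + (\<Sum>a\<in>edges_of g. \<pi> (head N a) * f a)
      = \<pi> (dest g) * d g + (\<Sum>a\<in>edges_of g. \<pi> (tail N a) * f a)"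
    using verts by (simp add: distrib_left sum.distrib)
  have "y (e, k, t, g) \<le> f e"
    unfolding f_def using yk[OF e] k by (intro member_le_sum) auto
  also have "f e \<le> (\<Sum>a\<in>edges_of g. f a)"
    using e f_nonneg finite_edges_of by (intro member_le_sum) auto
  also have "\<dots> \<le> (\<Sum>a\<in>edges_of g. (real (\<pi> (head N a)) - \<pi> (tail N a)) * f a)"
  proof (rule sum_mono)
    fix a assume a: "a \<in> edges_of g"
    \<comment> \<open>The potential has natural values, so a strict increase along an arc is at
      least 1.\<close>
    then have "1 \<le> real (\<pi> (head N a)) - \<pi> (tail N a)"
      using \<pi>[of a] edges_of_subset_arcs[of g] by (auto simp: of_nat_diff le_diff_eq)
    then show "f a \<le> (real (\<pi> (head N a)) - \<pi> (tail N a)) * f a"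
      using mult_right_mono[OF _ f_nonneg[OF a]] by fastforce
  qed
  also have "\<dots> = \<pi> (dest g) * d g - \<pi> (orig g) * d g"
    using eq by (simp add: left_diff_distrib sum_subtractf)
  also have "\<dots> \<le> d g * \<pi> (dest g)"
    using demand_nonneg[of g] g by (simp add: groups_def)
  finally show ?thesis .
qed

section \<open>Compactness, non-emptiness and convexity of the feasible set\<close>

lemma compact_feasible_flows: "compact (feasible_flows \<tau> B)"
proof -
  obtain \<pi> :: "'i \<Rightarrow> nat" where \<pi>: "\<And>e. e \<in> arcs N \<Longrightarrow> \<pi> (tail N e) < \<pi> (head N e)"
    using acyclic_potential[OF no_cycle] by blast
  \<comment> \<open>By \<open>flow_bound\<close> every feasible flow lies in this compact box, and
    the feasible set is cut out of it by closed linear constraints.\<close>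
  define box where "box = PiE flow_index (\<lambda>(e, k, t, g). {0..d g * \<pi> (dest g)})"
  define cons where "cons i g t = {y :: 'e \<times> nat \<times> nat \<times> 'g \<Rightarrow> real. (if i = orig g then d g else 0)
      + (\<Sum>e\<in>in_arcs N i \<inter> edges_of g. \<Sum>k\<in>{1, 2}. y (e, k, t, g))
    = (if i = dest g then d g else 0)
      + (\<Sum>e\<in>out_arcs N i \<inter> edges_of g. \<Sum>k\<in>{1, 2}. y (e, k, t, g))}" for i g t
  define budget where
    "budget g = {y. (\<Sum>t\<in>{1..T}. \<Sum>e\<in>edges_of g. y (e, 1 :: nat, t, g) * \<tau> e t) \<le> B g}" for g
  have "feasible_flows \<tau> B = box \<inter> ((\<Inter>i\<in>verts N. \<Inter>g\<in>groups. \<Inter>t\<in>{1..T}. cons i g t)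
      \<inter> (\<Inter>g\<in>GE. budget g))" (is "_ = ?R")
  proof (intro equalityI subsetI)
    fix y assume y: "y \<in> feasible_flows \<tau> B"
    then have adm: "y \<in> admissible_flows" by (simp add: feasible_flows_def)
    then have fl: "y \<in> flows" by (simp add: admissible_flows_def)
    have "y \<in> box"
      unfolding box_def PiE_iff
    proof (intro conjI ballI)
      fix x assume x: "x \<in> flow_index"
      then show "y x \<in> (case x of (e, k, t, g) \<Rightarrow> {0..d g * \<pi> (dest g)})"
        using flow_bound[OF \<pi> adm] flow_nonneg[OF fl x] by (cases x) auto
    next
      show "y \<in> extensional flow_index" using fl by (simp add: flows_def PiE_iff)
    qed
    then show "y \<in> ?R"
      using y by (simp add: feasible_flows_def admissible_flows_def cons_def budget_def)
  next
    fix y assume y: "y \<in> ?R"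
    then have "y \<in> flows"
      unfolding flows_def box_def by (auto simp: PiE_iff)
    with y show "y \<in> feasible_flows \<tau> B"
      by (simp add: feasible_flows_def admissible_flows_def cons_def budget_def)
  qed
  moreover have "compact box"
    unfolding box_def by (intro compact_PiE) (auto split: prod.splits)
  moreover have "closed (cons i g t)" for i g t
    unfolding cons_def by (intro closed_Collect_eq continuous_intros)
  moreover have "closed (budget g)" for g
    unfolding budget_def by (intro closed_Collect_le continuous_intros)
  ultimately show ?thesis
    by (auto intro!: compact_Int_closed closed_INT closed_Int)
qed

text \<open>Each group sends its whole demand along one fixed route on the toll-free lane 2 in every
  period. It then spends nothing, which any non-negative budget covers.\<close>

lemma feasible_flows_nonempty:
  assumes "\<forall>g\<in>GE. 0 \<le> B g"
  shows "feasible_flows \<tau> B \<noteq> {}"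
proof -
  obtain p where p: "\<And>g. g \<in> groups \<Longrightarrow> apath (orig g) (p g) (dest g)"
    using route_exists unfolding groups_def by metis
  define y where "y = (\<lambda>(e, k, t, g)\<in>flow_index. if k = 2 \<and> e \<in> set (p g) then d g else 0)"
  have y: "y (e, k, t, g) = (if k = 2 \<and> e \<in> set (p g) then d g else 0)"
    if "e \<in> edges_of g" "k \<in> {1, 2}" "t \<in> {1..T}" for e k t g
    using that by (simp add: y_def flow_index_edges_of)
  have "y \<in> flows"
    using demand_nonneg by (auto simp: flows_def y_def flow_index_def groups_on_def groups_def)
  moreover have "(if i = orig g then d g else 0) + (\<Sum>e\<in>in_arcs N i \<inter> edges_of g. \<Sum>k\<in>{1, 2}. y (e, k, t, g))
    = (if i = dest g then d g else 0) + (\<Sum>e\<in>out_arcs N i \<inter> edges_of g. \<Sum>k\<in>{1, 2}. y (e, k, t, g))"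
    if g: "g \<in> groups" and t: "t \<in> {1..T}" for i g t
  proof -
    have walk: "awalk (orig g) (p g) (dest g)" and dist: "distinct (p g)"
      using p[OF g] distinct_verts_imp_distinct by (auto simp: apath_def)
    have sub: "set (p g) \<subseteq> edges_of g"
      using walk p[OF g] g by (auto simp: edges_of_def groups_on_def awalk_def)
    \<comment> \<open>Here \<open>h\<close> stands for the head or the tail map, so that inflow and
      outflow are treated together. The route repeats no arc, so the sum over its arc set is the
      list sum of \<open>awalk_conservation\<close>.\<close>
    have count: "(\<Sum>e\<in>{e \<in> arcs N. h e = i} \<inter> edges_of g. \<Sum>k\<in>{1, 2}. y (e, k, t, g))
        = (\<Sum>e\<leftarrow>p g. if h e = i then d g else 0)" for h
    proof -
      have "(\<Sum>e\<in>{e \<in> arcs N. h e = i} \<inter> edges_of g. \<Sum>k\<in>{1, 2}. y (e, k, t, g))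
          = (\<Sum>e\<in>{e \<in> arcs N. h e = i} \<inter> edges_of g. if e \<in> set (p g) then d g else 0)"
        using t by (intro sum.cong) (auto simp: y)
      also have "\<dots> = (\<Sum>e\<in>set (p g). if h e = i then d g else 0)"
      proof -
        have "{e \<in> {e \<in> arcs N. h e = i} \<inter> edges_of g. e \<in> set (p g)} = {e \<in> set (p g). h e = i}"
          using sub edges_of_subset_arcs[of g] by auto
        then show ?thesis
          by (simp only: sum.inter_filter[symmetric] finite_Int finite_edges_of finite_set simp_thms)
      qed
      also have "\<dots> = (\<Sum>e\<leftarrow>p g. if h e = i then d g else 0)"
        using dist by (simp add: sum_list_distinct_conv_sum_set)
      finally show ?thesis .
    qed
    show ?thesis
      unfolding in_arcs_def out_arcs_def count by (rule awalk_conservation[OF walk])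
  qed
  moreover have "(\<Sum>t\<in>{1..T}. \<Sum>e\<in>edges_of g. y (e, 1, t, g) * \<tau> e t) \<le> B g" if "g \<in> GE" for g
    using assms that by (simp add: y)
  ultimately have "y \<in> feasible_flows \<tau> B"
    by (simp add: feasible_flows_def admissible_flows_def)
  then show ?thesis by auto
qed

lemma feasible_flows_convex:
  assumes x: "x \<in> feasible_flows \<tau> B" and y: "y \<in> feasible_flows \<tau> B" and u: "u \<in> {0..1}"
  shows "(\<lambda>i. u * x i + (1 - u) * y i) \<in> feasible_flows \<tau> B" (is "?z \<in> _")
proof -
  have "?z \<in> flows"
  proof -
    have fl: "x \<in> flows" "y \<in> flows"
      using x y by (simp_all add: feasible_flows_def admissible_flows_def)
    have "0 \<le> ?z i" if "i \<in> flow_index" for i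
      using flow_nonneg[OF fl(1) that] flow_nonneg[OF fl(2) that] u by simp
    \<comment> \<open>The weights sum to 1, so the combination of \<open>undefined\<close> with
      itself is again \<open>undefined\<close>, and extensionality survives.\<close>
    moreover have "?z i = undefined" if "i \<notin> flow_index" for i
      using PiE_arb[OF fl(1)[unfolded flows_def] that] PiE_arb[OF fl(2)[unfolded flows_def] that]
      by (simp add: algebra_simps)
    ultimately show ?thesis
      by (simp add: flows_def PiE_iff extensional_def)
  qed
  moreover have "(if i = orig g then d g else 0) + (\<Sum>e\<in>in_arcs N i \<inter> edges_of g. \<Sum>k\<in>{1, 2}. ?z (e, k, t, g))
    = (if i = dest g then d g else 0) + (\<Sum>e\<in>out_arcs N i \<inter> edges_of g. \<Sum>k\<in>{1, 2}. ?z (e, k, t, g))"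
    if i: "i \<in> verts N" and g: "g \<in> groups" and t: "t \<in> {1..T}" for i g t
  proof -
    have lin: "(\<Sum>e\<in>A. \<Sum>k\<in>{1, 2}. ?z (e, k, t, g)) = u * (\<Sum>e\<in>A. \<Sum>k\<in>{1, 2}. x (e, k, t, g))
        + (1 - u) * (\<Sum>e\<in>A. \<Sum>k\<in>{1, 2}. y (e, k, t, g))" for A
      unfolding sum_distrib_left sum.distrib ..
    have mix: "a + (u * b + (1 - u) * b') = c + (u * e + (1 - u) * e')"
      if "a + b = c + e" "a + b' = c + e'" for a b b' c e e' :: real
    proof -
      have "a + (u * b + (1 - u) * b') = u * (a + b) + (1 - u) * (a + b')"
        by (simp add: algebra_simps)
      also have "\<dots> = c + (u * e + (1 - u) * e')"
        unfolding that by (simp add: algebra_simps)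
      finally show ?thesis .
    qed
    show ?thesis
      unfolding lin using x y i g t by (intro mix conservation feasible_imp_admissible)
  qed
  moreover have "(\<Sum>t\<in>{1..T}. \<Sum>e\<in>edges_of g. ?z (e, 1, t, g) * \<tau> e t) \<le> B g" if g: "g \<in> GE" for g
  proof -
    have "(\<Sum>t\<in>{1..T}. \<Sum>e\<in>edges_of g. ?z (e, 1, t, g) * \<tau> e t)
        = u * (\<Sum>t\<in>{1..T}. \<Sum>e\<in>edges_of g. x (e, 1, t, g) * \<tau> e t)
          + (1 - u) * (\<Sum>t\<in>{1..T}. \<Sum>e\<in>edges_of g. y (e, 1, t, g) * \<tau> e t)"
      by (simp add: sum_distrib_left sum.distrib distrib_right mult.assoc)
    also have "\<dots> \<le> B g"
      using budget_constraint[OF x g] budget_constraint[OF y g] u by (intro convex_bound_le) auto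
    finally show ?thesis .
  qed
  ultimately show ?thesis
    by (simp add: feasible_flows_def admissible_flows_def)
qed

section \<open>Continuity of the costs\<close>

lemma continuous_on_cost:
  assumes "(e, k, t, g) \<in> flow_index"
  shows "continuous_on flows (\<lambda>y. cost \<tau> y e k t g)"
proof -
  have e: "e \<in> arcs N" and t: "t \<in> {1..T}"
    using assms by (auto simp: flow_index_def)
  have "mono_on {0..} (lat e)"
    using latency_strict_mono[OF e] by (rule strict_mono_on_imp_mono_on)
  then have lat: "continuous_on {0..} (lat e)"
    using convex_mono_continuous_on_atLeast latency_convex[OF e] by blast
  \<comment> \<open>Latencies are known to be continuous only on the non-negative half-line; on
    \<open>flows\<close> all lane flows stay there.\<close>
  have "continuous_on flows (\<lambda>y. lat e (lane_flow y e j t))" if j: "j \<in> {1, 2}" for j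
  proof (rule continuous_on_compose2[OF lat])
    show "continuous_on flows (\<lambda>y. lane_flow y e j t)"
      unfolding lane_flow_def by (intro continuous_intros)
    show "(\<lambda>y. lane_flow y e j t) ` flows \<subseteq> {0..}"
      using e t j by (auto simp: lane_flow_def flow_index_def intro!: sum_nonneg flow_nonneg)
  qed
  then show ?thesis
    using assms unfolding cost_def flow_index_def
    by (cases "k = 1 \<and> g \<in> GI") (auto intro!: continuous_intros)
qed

text \<open>Every conservation law and every budget involves the coordinates of a single group only,
  so a group can switch to its part of another feasible flow while the others stay put.\<close>

lemma feasible_flows_replace_group:
  assumes "x \<in> feasible_flows \<tau> B" "y \<in> feasible_flows \<tau> B"
  shows "(\<lambda>(e, k, t, h). if h = g then y (e, k, t, h) else x (e, k, t, h)) \<in> feasible_flows \<tau> B"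
    (is "?z \<in> _")
proof -
  have z: "?z (e, k, t, h) = (if h = g then y else x) (e, k, t, h)" for e k t h
    by simp
  have "?z \<in> flows"
    using assms by (auto simp: feasible_flows_def admissible_flows_def flows_def PiE_iff extensional_def)
  moreover have "(if i = orig h then d h else 0) + (\<Sum>e\<in>in_arcs N i \<inter> edges_of h. \<Sum>k\<in>{1, 2}. ?z (e, k, t, h))
    = (if i = dest h then d h else 0) + (\<Sum>e\<in>out_arcs N i \<inter> edges_of h. \<Sum>k\<in>{1, 2}. ?z (e, k, t, h))"
    if "i \<in> verts N" "h \<in> groups" "t \<in> {1..T}" for i h t
    unfolding z using that assms by (intro conservation) (auto intro: feasible_imp_admissible)
  moreover have "(\<Sum>t\<in>{1..T}. \<Sum>e\<in>edges_of h. ?z (e, 1, t, h) * \<tau> e t) \<le> B h" if "h \<in> GE" for h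
    unfolding z using that assms by (intro budget_constraint) auto
  ultimately show ?thesis
    by (simp add: feasible_flows_def admissible_flows_def)
qed

text \<open>This carries the pairing over all flow coordinates to the sum over one group in the
  definition of equilibrium.\<close>

lemma sum_flow_index_group:
  fixes f :: "'e \<times> nat \<times> nat \<times> 'g \<Rightarrow> real"
  assumes "\<And>e k t h. h \<noteq> g \<Longrightarrow> f (e, k, t, h) = 0"
  shows "(\<Sum>x\<in>flow_index. f x) = (\<Sum>e\<in>edges_of g. \<Sum>k\<in>{1, 2}. \<Sum>t\<in>{1..T}. f (e, k, t, g))"
proof -
  let ?J = "edges_of g \<times> {1, 2} \<times> {1..T}" and ?h = "\<lambda>(e, k, t). (e, k, t, g)"
  have "(\<Sum>x\<in>flow_index. f x) = (\<Sum>x\<in>?h ` ?J. f x)"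
  proof (rule sum.mono_neutral_right[OF finite_flow_index])
    show "?h ` ?J \<subseteq> flow_index" by (auto simp: flow_index_edges_of)
    show "\<forall>x\<in>flow_index - ?h ` ?J. f x = 0"
    proof
      fix x assume x: "x \<in> flow_index - ?h ` ?J"
      obtain e k t h where xe: "x = (e, k, t, h)" by (cases x)
      have "h \<noteq> g"
      proof
        assume "h = g"
        then have "x = ?h (e, k, t)" "(e, k, t) \<in> ?J"
          using x xe by (auto simp: flow_index_edges_of)
        then show False using x by blast
      qed
      then show "f x = 0" using assms xe by simp
    qed
  qed
  also have "\<dots> = (\<Sum>x\<in>?J. f (?h x))"
    by (subst sum.reindex) (auto simp: inj_on_def)
  also have "\<dots> = (\<Sum>e\<in>edges_of g. \<Sum>k\<in>{1, 2}. \<Sum>t\<in>{1..T}. f (e, k, t, g))"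
    by (simp add: sum.cartesian_product case_prod_unfold)
  finally show ?thesis .
qed

section \<open>Existence of equilibria\<close>

lemma cbcp_equilibria_nonempty:
  assumes "\<forall>g\<in>GE. 0 \<le> B g"
  shows "cbcp_equilibria \<tau> B \<noteq> {}"
proof -
  define F where "F y = (\<lambda>(e, k, t, g). cost \<tau> y e k t g)" for y
  have "\<exists>x\<in>feasible_flows \<tau> B. \<forall>y\<in>feasible_flows \<tau> B. 0 \<le> (\<Sum>i\<in>flow_index. (y i - x i) * F x i)"
  proof (rule variational_inequality_compact_convex)
    show "continuous_on (feasible_flows \<tau> B) (\<lambda>y. F y i)" if "i \<in> flow_index" for i
    proof (rule continuous_on_subset)
      show "continuous_on flows (\<lambda>y. F y i)"
        using that continuous_on_cost by (cases i) (auto simp: F_def)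
      show "feasible_flows \<tau> B \<subseteq> flows"
        by (auto simp: feasible_flows_def admissible_flows_def)
    qed
  qed (use assms compact_feasible_flows feasible_flows_nonempty finite_flow_index feasible_flows_convex
      in blast)+
  then obtain x where x: "x \<in> feasible_flows \<tau> B"
    and vi: "\<And>y. y \<in> feasible_flows \<tau> B \<Longrightarrow> 0 \<le> (\<Sum>i\<in>flow_index. (y i - x i) * F x i)"
    by blast
  have "0 \<le> (\<Sum>e\<in>edges_of g. \<Sum>k\<in>{1, 2}. \<Sum>t\<in>{1..T}.
      (y (e, k, t, g) - x (e, k, t, g)) * cost \<tau> x e k t g)" if y: "y \<in> feasible_flows \<tau> B" for y g
  proof -
    \<comment> \<open>The flow \<open>z\<close> differs from \<open>x\<close> only in the
      coordinates of \<open>g\<close>, so the other groups contribute zero and the joint inequality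
      becomes that of \<open>g\<close>.\<close>
    define z where "z = (\<lambda>(e, k, t, h). if h = g then y (e, k, t, h) else x (e, k, t, h))"
    have "0 \<le> (\<Sum>i\<in>flow_index. (z i - x i) * F x i)"
      using vi feasible_flows_replace_group[OF x y] by (simp add: z_def)
    also have "\<dots> = (\<Sum>e\<in>edges_of g. \<Sum>k\<in>{1, 2}. \<Sum>t\<in>{1..T}.
        (z (e, k, t, g) - x (e, k, t, g)) * F x (e, k, t, g))"
      by (rule sum_flow_index_group) (simp add: z_def)
    finally show ?thesis by (simp add: z_def F_def)
  qed
  with x show ?thesis by (auto simp: cbcp_equilibria_def)
qed

end

theorem proposition4p2:
  fixes N :: "('i, 'e) pre_digraph" and T :: nat and GE GI :: "'g set"
    and orig dest :: "'g \<Rightarrow> 'i" and d :: "'g \<Rightarrow> real" and v :: "'g \<Rightarrow> nat \<Rightarrow> real"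
    and lat :: "'e \<Rightarrow> real \<Rightarrow> real" and \<tau> :: "'e \<Rightarrow> nat \<Rightarrow> real" and B :: "'g \<Rightarrow> real"
  assumes "cbcp_network N T GE GI orig dest d v lat"
    and "\<forall>e\<in>arcs N. \<forall>t\<in>{1..T}. 0 \<le> \<tau> e t"
    and "\<forall>g\<in>GE. 0 \<le> B g"
  shows "cbcp_network.cbcp_equilibria N T GE GI orig dest d v lat \<tau> B \<noteq> {}"
  using cbcp_network.cbcp_equilibria_nonempty[OF assms(1,3)] .

end
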